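(* Let $\pi\in S_n$ be such that $G_\pi$ is connected with domination number $k$, let $D$ be a minimum dominating set of $G_\pi$, and let $a\in D$ be the element of $D$ appearing rightmost in the one-line notation of $\pi$. Let $\tau\in S_{n+1}$ be the permutation obtained by inserting $n+1$ immediately to the left of $a$ in the one-line notation of $\pi$. Then $G_\tau$ is a connected permutation graph on $n+1$ vertices with domination number $k$.
   Context: For a permutation $\pi$ of $[n]=\{1,\dots,n\}$ (one-line notation $[\pi(1),\dots,\pi(n)]$), the permutation graph $G_\pi$ has vertex set $[n]$ and an edge between $i<j$ iff $\pi^{-1}(i)>\pi^{-1}(j)$. A dominating set is a set $D$ of vertices such that every vertex is in $D$ or adjacent to a vertex of $D$; the domination number is the minimum size of a dominating set, and a minimum dominating set is one of that size. *)

theory Defs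
  imports
    Complex_Main
    "HOL-Combinatorics.Permutations"
    "Graph_Theory.Graph_Theory"
begin

(* A simple undirected graph is represented by its symmetric arc relation: the edge {i, j}
   is the pair of arcs (i, j) and (j, i). *)
definition permutation_graph :: "nat \<Rightarrow> (nat \<Rightarrow> nat) \<Rightarrow> nat pair_pre_digraph" where
  "permutation_graph n \<pi> =
     \<lparr> pverts = {1..n},
       parcs = {(i, j). i \<in> {1..n} \<and> j \<in> {1..n} \<and>
                 (i < j \<and> inv \<pi> i > inv \<pi> j \<or> j < i \<and> inv \<pi> j > inv \<pi> i)} \<rparr>"

lemma pair_graph_permutation_graph: "pair_graph (permutation_graph n \<pi>)"
proof -
  have "finite (parcs (permutation_graph n \<pi>))"
    by (rule finite_subset[of _ "{1..n} \<times> {1..n}"]) (auto simp: permutation_graph_def)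
  then show ?thesis
    by unfold_locales (auto simp: permutation_graph_def symmetric_def sym_def)
qed

definition dominating_set :: "('a, 'b) pre_digraph \<Rightarrow> 'a set \<Rightarrow> bool" where
  "dominating_set G D \<longleftrightarrow>
     D \<subseteq> verts G \<and> (\<forall>v \<in> verts G. v \<in> D \<or> (\<exists>d \<in> D. v \<rightarrow>\<^bsub>G\<^esub> d))"

(* Meant for finite graphs only: card is 0 on infinite sets. *)
definition domination_number :: "('a, 'b) pre_digraph \<Rightarrow> nat" where
  "domination_number G = (LEAST m. \<exists>D. dominating_set G D \<and> card D = m)"

definition minimum_dominating_set :: "('a, 'b) pre_digraph \<Rightarrow> 'a set \<Rightarrow> bool" where
  "minimum_dominating_set G D \<longleftrightarrow> dominating_set G D \<and> card D = domination_number G"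

definition one_line :: "nat \<Rightarrow> (nat \<Rightarrow> nat) \<Rightarrow> nat list" where
  "one_line n \<pi> = map \<pi> [1..<Suc n]"

(* Lists are indexed from 0, one-line notation from 1. *)
definition perm_of_one_line :: "nat list \<Rightarrow> nat \<Rightarrow> nat" where
  "perm_of_one_line w i = (if i \<in> {1..length w} then w ! (i - 1) else i)"

lemma one_line_perm_of_one_line: "one_line (length w) (perm_of_one_line w) = w"
  by (rule nth_equalityI) (auto simp: one_line_def perm_of_one_line_def simp del: upt_Suc)

lemma perm_of_one_line_one_line:
  assumes "\<pi> permutes {1..n}"
  shows "perm_of_one_line (one_line n \<pi>) = \<pi>"
proof
  fix i
  show "perm_of_one_line (one_line n \<pi>) i = \<pi> i"
    using permutes_not_in[OF assms, of i]
    by (auto simp: one_line_def perm_of_one_line_def simp del: upt_Suc)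
qed

definition insert_left_of :: "'a \<Rightarrow> 'a \<Rightarrow> 'a list \<Rightarrow> 'a list" where
  "insert_left_of x a w = takeWhile (\<lambda>y. y \<noteq> a) w @ x # dropWhile (\<lambda>y. y \<noteq> a) w"

lemma insert_left_of_append:
  "a \<notin> set us \<Longrightarrow> insert_left_of x a (us @ a # vs) = us @ x # a # vs"
  by (induction us) (auto simp: insert_left_of_def)

definition insert_max_left_of :: "nat \<Rightarrow> nat \<Rightarrow> (nat \<Rightarrow> nat) \<Rightarrow> nat \<Rightarrow> nat" where
  "insert_max_left_of n a \<pi> = perm_of_one_line (insert_left_of (Suc n) a (one_line n \<pi>))"

lemma one_line_insert_max_left_of:
  "one_line (Suc n) (insert_max_left_of n a \<pi>) = insert_left_of (Suc n) a (one_line n \<pi>)"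
proof -
  have "length (insert_left_of x a w) = Suc (length w)" for x :: nat and w
    by (induction w) (auto simp: insert_left_of_def)
  then have "length (insert_left_of (Suc n) a (one_line n \<pi>)) = Suc n"
    by (simp add: one_line_def del: upt_Suc)
  then show ?thesis
    unfolding insert_max_left_of_def by (metis one_line_perm_of_one_line)
qed

end

theory Submission
  imports Defs
begin

text \<open>
  Deleting \<open>n + 1\<close> from \<open>G\<^sub>\<tau>\<close> gives back \<open>G\<^sub>\<pi>\<close>, and the neighbours of \<open>n + 1\<close> are exactly
  \<open>a\<close> and the entries to the right of \<open>a\<close>. So \<open>G\<^sub>\<tau>\<close> is connected and \<open>D\<close> still dominates.
  Conversely, let \<open>m\<close> be the largest element of \<open>D\<close>. An entry to the right of \<open>a\<close> is
  dominated by a larger element of \<open>D\<close> on its left, hence also by \<open>m\<close>; so in a dominating set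
  of \<open>G\<^sub>\<tau>\<close> the vertex \<open>n + 1\<close> can be replaced by \<open>m\<close>, giving a dominating set of \<open>G\<^sub>\<pi>\<close>.
\<close>

text \<open>Every vertex is routed through \<open>y\<close>: an old one by a walk in
  \<open>G\<close>, the new one by its single arc to \<open>y\<close>. One arc suffices because
  connectedness refers to the symmetric closure.\<close>

lemma connected_insert_vertex:
  assumes conn: "Digraph_Component.connected G"
    and verts: "verts H = insert x (verts G)"
    and sub: "arcs_ends G \<subseteq> arcs_ends H"
    and y: "y \<in> verts G" "x \<rightarrow>\<^bsub>H\<^esub> y"
  shows "Digraph_Component.connected H"
proof -
  let ?R = "rtrancl_on (verts H) ((arcs_ends H)\<^sup>s)"
  have old: "(u, v) \<in> ?R" if "u \<in> verts G" "v \<in> verts G" for u v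
  proof -
    have "(u, v) \<in> rtrancl_on (verts G) ((arcs_ends G)\<^sup>s)"
      using conn that by (auto simp: connected_conv)
    then show ?thesis
      by (rule rtrancl_on_mono[rotated 2]) (use verts sub in \<open>auto simp: symcl_def\<close>)
  qed
  have "(x, y) \<in> ?R" "(y, x) \<in> ?R"
    using y verts by (auto intro!: rtrancl_on_into_rtrancl_on[OF rtrancl_on_refl] simp: symcl_def)
  then have via: "(u, y) \<in> ?R" "(y, u) \<in> ?R" if "u \<in> verts H" for u
    using old[of u y] old[of y u] y that verts by auto
  show ?thesis
    unfolding connected_conv
  proof (intro conjI ballI)
    show "verts H \<noteq> {}" using verts by simp
    fix u v assume "u \<in> verts H" "v \<in> verts H"
    then show "(u, v) \<in> ?R" by (intro rtrancl_on_trans[OF via(1) via(2)])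
  qed
qed

lemma domination_number_le:
  "dominating_set G D \<Longrightarrow> domination_number G \<le> card D"
  unfolding domination_number_def by (rule Least_le) auto

lemma dominating_set_verts: "dominating_set G (verts G)"
  by (auto simp: dominating_set_def)

text \<open>The full vertex set dominates, so the \<open>LEAST\<close> defining the domination
  number is attained.\<close>

lemma ex_minimum_dominating_set: "\<exists>D. minimum_dominating_set G D"
  unfolding minimum_dominating_set_def domination_number_def
  by (rule LeastI_ex) (use dominating_set_verts in blast)

lemma pverts_permutation_graph [simp]: "pverts (permutation_graph n \<pi>) = {1..n}"
  by (simp add: permutation_graph_def)

lemma verts_permutation_graph: "verts (permutation_graph n \<pi>) = {1..n}"
  by simp

lemma adj_permutation_graph_iff:
  "u \<rightarrow>\<^bsub>permutation_graph n \<pi>\<^esub> v \<longleftrightarrow> u \<in> {1..n} \<and> v \<in> {1..n} \<and>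
     (u < v \<and> inv \<pi> v < inv \<pi> u \<or> v < u \<and> inv \<pi> u < inv \<pi> v)"
  by (auto simp: permutation_graph_def)

text \<open>This positional form replaces the list operations in all later computations. Index 0
  falls into the first branch, correctly so because \<pi> fixes 0.\<close>

lemma insert_max_left_of_apply:
  assumes perm: "\<pi> permutes {1..n}" and a: "a \<in> {1..n}"
  shows "insert_max_left_of n a \<pi> i =
    (if i < inv \<pi> a then \<pi> i else if i = inv \<pi> a then Suc n
     else if i \<le> Suc n then \<pi> (i - 1) else i)"
proof -
  define p where "p = inv \<pi> a"
  have p: "1 \<le> p" "p \<le> n" "\<pi> p = a"
    using a permutes_in_image[OF permutes_inv[OF perm], of a] permutes_inverses(1)[OF perm]
    by (auto simp: p_def)
  let ?us = "map \<pi> [1..<p]" and ?vs = "map \<pi> [Suc p..<Suc n]"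
  have "[1..<Suc n] = [1..<p] @ [p..<Suc n]"
    using p upt_add_eq_append[of 1 p "Suc n - p"] by (simp del: upt_Suc)
  also have "[p..<Suc n] = p # [Suc p..<Suc n]"
    using p by (intro upt_conv_Cons) auto
  finally have "[1..<Suc n] = [1..<p] @ p # [Suc p..<Suc n]" .
  then have "one_line n \<pi> = ?us @ a # ?vs"
    using p by (simp add: one_line_def del: upt_Suc)
  \<comment> \<open>The insertion happens at the first occurrence of \<open>a\<close>, so an
    occurrence before position \<open>p\<close> has to be excluded.\<close>
  moreover have "a \<notin> set ?us"
  proof
    assume "a \<in> set ?us"
    then obtain j where "j < p" "\<pi> j = a" by auto
    then show False using perm permutes_inverses(2)[OF perm] by (auto simp: p_def)
  qed
  ultimately have w: "insert_left_of (Suc n) a (one_line n \<pi>) = ?us @ Suc n # a # ?vs"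
    by (simp add: insert_left_of_append del: upt_Suc)
  have \<tau>: "insert_max_left_of n a \<pi> i =
      (if i \<in> {1..Suc n} then (?us @ Suc n # a # ?vs) ! (i - 1) else i)"
    using p by (simp add: insert_max_left_of_def w perm_of_one_line_def del: upt_Suc)
  \<comment> \<open>In the last case the lookup passes \<open>?us\<close> and the two entries
    \<open>Suc n\<close> and \<open>a\<close>, and lands at index \<open>l - p\<close> of
    \<open>?vs\<close>, which is \<open>\<pi> (Suc l)\<close>.\<close>
  consider "i = 0" | "0 < i" "i < p" | "i = p" | "i = Suc p" | "Suc (Suc n) \<le> i"
    | l where "i = Suc (Suc l)" "p \<le> l" "l < n"
    by (cases i; cases "i - 1") force+
  then show ?thesis
    unfolding \<tau> p_def[symmetric]
    using p permutes_not_in[OF perm, of 0]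
    by cases (auto simp: nth_append Suc_diff_le simp del: upt_Suc)
qed

lemma insert_max_left_of_permutes:
  assumes perm: "\<pi> permutes {1..n}" and a: "a \<in> {1..n}"
  shows "insert_max_left_of n a \<pi> permutes {1..Suc n}"
proof -
  let ?\<tau> = "insert_max_left_of n a \<pi>"
  have p: "1 \<le> inv \<pi> a" "inv \<pi> a \<le> n"
    using a permutes_in_image[OF permutes_inv[OF perm], of a] by auto
  have in_iff: "\<pi> i \<in> {1..n} \<longleftrightarrow> i \<in> {1..n}" for i
    using permutes_in_image[OF perm] .
  have maps: "?\<tau> ` {1..Suc n} \<subseteq> {1..Suc n}"
  proof (rule image_subsetI)
    fix i assume "i \<in> {1..Suc n}"
    then show "?\<tau> i \<in> {1..Suc n}"
      using p in_iff[of i] in_iff[of "i - 1"] by (auto simp: insert_max_left_of_apply[OF perm a])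
  qed
  have "inj_on ?\<tau> {1..Suc n}"
  proof (rule inj_on_inverseI)
    fix i assume i: "i \<in> {1..Suc n}"
    \<comment> \<open>An explicit left inverse: it returns the position of the value
      \<open>j\<close> in the new one-line notation.\<close>
    let ?\<sigma> = "\<lambda>j. if j = Suc n then inv \<pi> a else if inv \<pi> j < inv \<pi> a then inv \<pi> j else Suc (inv \<pi> j)"
    have ne: "\<pi> l \<noteq> Suc n" if "l \<in> {1..n}" for l
      using in_iff[of l] that by auto
    consider "i < inv \<pi> a" | "i = inv \<pi> a" | "inv \<pi> a < i" by linarith
    then show "?\<sigma> (?\<tau> i) = i"
      using i p ne[of i] ne[of "i - 1"]
      by cases (auto simp: insert_max_left_of_apply[OF perm a] permutes_inverses(2)[OF perm])
  qed
  with maps have "bij_betw ?\<tau> {1..Suc n} {1..Suc n}"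
    by (simp add: bij_betw_def endo_inj_surj)
  then show ?thesis
    by (rule bij_imp_permutes) (use p permutes_not_in[OF perm] in
      \<open>auto simp: insert_max_left_of_apply[OF perm a]\<close>)
qed

text \<open>Once \<tau> is known to be a permutation, a claim about \<open>inv\<close> turns into an
  evaluation of \<tau> at the proposed position.\<close>

lemma inv_insert_max_left_of:
  assumes perm: "\<pi> permutes {1..n}" and a: "a \<in> {1..n}" and j: "j \<in> {1..n}"
  shows "inv (insert_max_left_of n a \<pi>) j =
    (if inv \<pi> j < inv \<pi> a then inv \<pi> j else Suc (inv \<pi> j))"
proof -
  have "inv \<pi> j \<in> {1..n}"
    using j permutes_in_image[OF permutes_inv[OF perm]] by blast
  then show ?thesis
    unfolding permutes_inv_eq[OF insert_max_left_of_permutes[OF perm a]]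
    by (auto simp: insert_max_left_of_apply[OF perm a] permutes_inverses[OF perm])
qed

lemma inv_insert_max_left_of_max:
  assumes perm: "\<pi> permutes {1..n}" and a: "a \<in> {1..n}"
  shows "inv (insert_max_left_of n a \<pi>) (Suc n) = inv \<pi> a"
  unfolding permutes_inv_eq[OF insert_max_left_of_permutes[OF perm a]]
  by (auto simp: insert_max_left_of_apply[OF perm a])

text \<open>The insertion moves the old entries by a strictly increasing map of positions, which
  keeps their inversions.\<close>

lemma adj_insert_max_left_of_iff:
  assumes perm: "\<pi> permutes {1..n}" and a: "a \<in> {1..n}" and uv: "u \<in> {1..n}" "v \<in> {1..n}"
  shows "u \<rightarrow>\<^bsub>permutation_graph (Suc n) (insert_max_left_of n a \<pi>)\<^esub> v \<longleftrightarrow>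
    u \<rightarrow>\<^bsub>permutation_graph n \<pi>\<^esub> v"
  using uv unfolding adj_permutation_graph_iff
  by (auto simp: inv_insert_max_left_of[OF perm a])

text \<open>The largest value is inverted exactly with the entries to its right, and these start
  with \<open>a\<close>. Both directions of the arc are recorded: connectedness uses the first, the
  replacement argument the second.\<close>

lemma adj_insert_max_left_of_max_iff:
  assumes perm: "\<pi> permutes {1..n}" and a: "a \<in> {1..n}" and v: "v \<in> {1..n}"
  shows "Suc n \<rightarrow>\<^bsub>permutation_graph (Suc n) (insert_max_left_of n a \<pi>)\<^esub> v \<longleftrightarrow>
      inv \<pi> a \<le> inv \<pi> v"
    and "v \<rightarrow>\<^bsub>permutation_graph (Suc n) (insert_max_left_of n a \<pi>)\<^esub> Suc n \<longleftrightarrow>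
      inv \<pi> a \<le> inv \<pi> v"
  using v unfolding adj_permutation_graph_iff
  by (auto simp: inv_insert_max_left_of[OF perm a] inv_insert_max_left_of_max[OF perm a])

lemma Max_dominates_right_of_rightmost:
  assumes perm: "\<pi> permutes {1..n}"
    and dom: "dominating_set (permutation_graph n \<pi>) D"
    and a: "a \<in> D" and right: "\<forall>d \<in> D. inv \<pi> d \<le> inv \<pi> a"
    and v: "v \<in> {1..n}" "inv \<pi> a \<le> inv \<pi> v"
  shows "v = Max D \<or> v \<rightarrow>\<^bsub>permutation_graph n \<pi>\<^esub> Max D"
proof -
  have D: "D \<subseteq> {1..n}"
    using dom by (simp add: dominating_set_def)
  then have fin: "finite D"
    by (rule finite_subset) simp
  have m: "Max D \<in> D"
    using fin a by (intro Max_in) auto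
  have "\<exists>d \<in> D. v \<le> d"
  proof (cases "v \<in> D")
    case False
    then obtain d where "d \<in> D" "v \<rightarrow>\<^bsub>permutation_graph n \<pi>\<^esub> d"
      using dom v(1) by (auto simp: dominating_set_def)
    \<comment> \<open>No element of \<open>D\<close> stands to the right of \<open>a\<close>, so
      \<open>d\<close> is not to the right of \<open>v\<close>; an edge between them then forces
      \<open>v < d\<close>.\<close>
    moreover from this have "inv \<pi> d \<le> inv \<pi> v"
      using right v(2) by fastforce
    ultimately show ?thesis
      unfolding adj_permutation_graph_iff by (meson less_imp_le not_le)
  qed auto
  then have le: "v \<le> Max D"
    using fin by (meson Max_ge order_trans)
  have pos: "inv \<pi> (Max D) \<le> inv \<pi> v"
    using right m v(2) by fastforce
  \<comment> \<open>Distinct entries have distinct positions, which makes the inequality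
    \<open>pos\<close> strict, as adjacency requires.\<close>
  have "inv \<pi> (Max D) \<noteq> inv \<pi> v" if "v \<noteq> Max D"
    using that permutes_inj[OF permutes_inv[OF perm]] by (auto dest: injD)
  then show ?thesis
    using le pos m D v(1) unfolding adj_permutation_graph_iff by force
qed

lemma dominating_set_replace_max:
  assumes perm: "\<pi> permutes {1..n}"
    and dom: "dominating_set (permutation_graph n \<pi>) D"
    and a: "a \<in> D" and right: "\<forall>d \<in> D. inv \<pi> d \<le> inv \<pi> a"
    and dom': "dominating_set (permutation_graph (Suc n) (insert_max_left_of n a \<pi>)) D'"
  shows "\<exists>E. dominating_set (permutation_graph n \<pi>) E \<and> card E \<le> card D'"
proof -
  let ?G = "permutation_graph n \<pi>"
  let ?H = "permutation_graph (Suc n) (insert_max_left_of n a \<pi>)"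
  have D: "D \<subseteq> {1..n}"
    using dom by (simp add: dominating_set_def)
  with a have a': "a \<in> {1..n}" by auto
  have m: "Max D \<in> {1..n}"
    using D a Max_in[of D] finite_subset[OF D] by blast
  have D': "D' \<subseteq> {1..Suc n}"
    using dom' by (simp add: dominating_set_def)
  then have fin: "finite D'"
    by (rule finite_subset) simp
  \<comment> \<open>\<open>Max D\<close> may already belong to \<open>D'\<close>, so the exchange
    can lower the cardinality.\<close>
  define E where "E = (if Suc n \<in> D' then insert (Max D) (D' - {Suc n}) else D')"
  have "card E \<le> card D'"
    \<comment> \<open>The cited bound requires \<open>card D'\<close> to be positive, hence the
      separate case of empty \<open>D'\<close>.\<close>
    using card_insert_le_m1[of "card D'" "D' - {Suc n}" "Max D"] fin
    by (cases "D' = {}") (auto simp: E_def card_gt_0_iff)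
  moreover have "dominating_set ?G E"
    unfolding dominating_set_def verts_permutation_graph
  proof (intro conjI ballI)
    show "E \<subseteq> {1..n}"
      using D' m by (auto simp: E_def atLeastAtMostSuc_conv)
    fix v assume v: "v \<in> {1..n}"
    have sub: "d \<in> E" if "d \<in> D'" "d \<noteq> Suc n" for d
      using that by (auto simp: E_def)
    consider "v \<in> D'" | d where "d \<in> D'" "v \<rightarrow>\<^bsub>?H\<^esub> d"
      using dom' v unfolding dominating_set_def verts_permutation_graph by fastforce
    then show "v \<in> E \<or> (\<exists>d\<in>E. v \<rightarrow>\<^bsub>?G\<^esub> d)"
    proof cases
      case 1
      with v sub show ?thesis by auto
    next
      case 2
      show ?thesis
      \<comment> \<open>If \<open>v\<close> was dominated by \<open>Suc n\<close>, it is
        \<open>a\<close> or stands to the right of \<open>a\<close>, and \<open>Max D\<close> takes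
        over; any other dominator is an old vertex and its edge to \<open>v\<close> is already
        present in \<open>?G\<close>.\<close>
      proof (cases "d = Suc n")
        case True
        with 2 v have "inv \<pi> a \<le> inv \<pi> v"
          using adj_insert_max_left_of_max_iff(2)[OF perm a'] by blast
        then have "v = Max D \<or> v \<rightarrow>\<^bsub>?G\<^esub> Max D"
          by (rule Max_dominates_right_of_rightmost[OF perm dom a right v])
        moreover have "Max D \<in> E"
          using True 2 by (simp add: E_def)
        ultimately show ?thesis by blast
      next
        case False
        with 2 D' have "d \<in> {1..n}" by fastforce
        with 2 v have "v \<rightarrow>\<^bsub>?G\<^esub> d"
          using adj_insert_max_left_of_iff[OF perm a'] by blast
        with sub 2 False show ?thesis by blast
      qed
    qed
  qed
  ultimately show ?thesis by blast
qed

theorem theorem8: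
  fixes n k a :: nat and \<pi> \<tau> :: "nat \<Rightarrow> nat" and D :: "nat set"
  assumes "\<pi> permutes {1..n}"
    and "Digraph_Component.connected (permutation_graph n \<pi>)"
    and "domination_number (permutation_graph n \<pi>) = k"
    and "minimum_dominating_set (permutation_graph n \<pi>) D"
    and "a \<in> D" and "\<forall>d \<in> D. inv \<pi> d \<le> inv \<pi> a"
    and "\<tau> = insert_max_left_of n a \<pi>"
  shows "\<tau> permutes {1..n + 1} \<and>
    Digraph_Component.connected (permutation_graph (n + 1) \<tau>) \<and>
    card (verts (permutation_graph (n + 1) \<tau>)) = n + 1 \<and>
    domination_number (permutation_graph (n + 1) \<tau>) = k"
proof -
  let ?G = "permutation_graph n \<pi>"
  let ?H = "permutation_graph (Suc n) \<tau>"
  note perm = assms(1)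
  have dom: "dominating_set ?G D" and k: "card D = k"
    using assms(3,4) by (auto simp: minimum_dominating_set_def)
  have D: "D \<subseteq> {1..n}"
    using dom by (simp add: dominating_set_def)
  with assms(5) have a: "a \<in> {1..n}" by auto
  note adj = adj_insert_max_left_of_iff[OF perm a, folded assms(7)]
  note adj_max = adj_insert_max_left_of_max_iff[OF perm a, folded assms(7)]
  have conn: "Digraph_Component.connected ?H"
  proof (rule connected_insert_vertex[OF assms(2)])
    show "verts ?H = insert (Suc n) (verts ?G)"
      by auto
    show "arcs_ends ?G \<subseteq> arcs_ends ?H"
    proof (rule subrelI)
      fix u v assume uv: "u \<rightarrow>\<^bsub>?G\<^esub> v"
      then have "u \<in> {1..n}" "v \<in> {1..n}"
        unfolding adj_permutation_graph_iff by auto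
      with uv adj show "u \<rightarrow>\<^bsub>?H\<^esub> v" by blast
    qed
    \<comment> \<open>The new vertex is attached at \<open>a\<close>, the entry immediately to its
      right.\<close>
    show "a \<in> verts ?G" "Suc n \<rightarrow>\<^bsub>?H\<^esub> a"
      using a adj_max(1)[OF a] by simp_all
  qed
  have "dominating_set ?H D"
    unfolding dominating_set_def verts_permutation_graph
  proof (intro conjI ballI)
    show "D \<subseteq> {1..Suc n}" using D by auto
    fix v assume "v \<in> {1..Suc n}"
    then consider "v = Suc n" | "v \<in> {1..n}" by fastforce
    then show "v \<in> D \<or> (\<exists>d\<in>D. v \<rightarrow>\<^bsub>?H\<^esub> d)"
    proof cases
      case 1
      \<comment> \<open>The new vertex is dominated by \<open>a\<close>, which lies in
        \<open>D\<close>.\<close>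
      then show ?thesis using adj_max(1)[OF a] assms(5) by blast
    next
      case 2
      then show ?thesis
        using dom D adj unfolding dominating_set_def verts_permutation_graph by blast
    qed
  qed
  then have upper: "domination_number ?H \<le> k"
    using domination_number_le k by metis
  obtain D' where D': "dominating_set ?H D'" "card D' = domination_number ?H"
    using ex_minimum_dominating_set[of ?H] by (auto simp: minimum_dominating_set_def)
  obtain E where "dominating_set ?G E" "card E \<le> card D'"
    using dominating_set_replace_max[OF perm dom assms(5,6)] D'(1) assms(7) by blast
  \<comment> \<open>The chain is \<open>k \<le> card E \<le> card D'\<close>, and \<open>D'\<close>
    was chosen of minimum size in \<open>?H\<close>.\<close>
  then have "k \<le> domination_number ?H"
    using domination_number_le assms(3) D'(2) by (metis order_trans)
  with upper conn show ?thesis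
    using insert_max_left_of_permutes[OF perm a] assms(7) by simp
qed

end
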